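(* Assume $\Delta>0$. The following are equivalent: (1) $\mathcal C(\mathbb Z)\simeq\mathbb Z/2\mathbb Z\oplus\mathbb Z$; (2) the image of $\alpha:\mathcal C(\mathbb Z)\to\mathbb Q^\times/\mathbb Q^{\times2}$ has exactly $4$ elements.
   Context: Let $d$ be a squarefree integer with $d\neq 1$, and put $\Delta=d$ if $d\equiv 1\pmod 4$ and $\Delta=4d$ if $d\equiv 2,3\pmod 4$. Let $\mathcal C(\mathbb Z)=\{(x,y)\in\mathbb Z^2: x^2-\Delta y^2=4\}$, an abelian group with neutral element $(2,0)$ and addition $(r,s)+(t,u)=\big(\frac{rt+\Delta su}{2},\frac{ru+st}{2}\big)$. The map $\alpha$ is given by $\alpha(x,y)=(x+2)\mathbb Q^{\times2}$ if $x\neq-2$ and $\alpha(-2,0)=-\Delta\,\mathbb Q^{\times2}$. *)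

theory Defs
  imports "HOL-Algebra.Algebra" "HOL-Computational_Algebra.Squarefree"
begin

text \<open>For squarefree \<open>d\<close> the second case is exactly \<open>d\<close> congruent to 2 or 3 modulo 4.\<close>

definition disc :: "int \<Rightarrow> int" where
  "disc d = (if d mod 4 = 1 then d else 4 * d)"

text \<open>The divisions by 2 are exact on the carrier, see \<open>conic_div_exact\<close> below.\<close>

definition conic_group :: "int \<Rightarrow> (int \<times> int) monoid" where
  "conic_group D =
    \<lparr>carrier = {(x, y). x\<^sup>2 - D * y\<^sup>2 = 4},
     monoid.mult = (\<lambda>(r, s) (t, u). ((r * t + D * s * u) div 2, (r * u + s * t) div 2)),
     one = (2, 0)\<rparr>"

definition rat_units :: "rat monoid" where
  "rat_units = \<lparr>carrier = {q. q \<noteq> 0}, monoid.mult = (*), one = 1\<rparr>"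

definition rat_squares :: "rat set" where
  "rat_squares = {q\<^sup>2 | q. q \<noteq> 0}"

text \<open>On the conic, \<open>x = -2\<close> happens only at the point \<open>(-2, 0)\<close>, see \<open>conic_minus_two\<close> below.\<close>

definition conic_alpha :: "int \<Rightarrow> int \<times> int \<Rightarrow> rat set" where
  "conic_alpha D = (\<lambda>(x, y).
     rat_squares #>\<^bsub>rat_units\<^esub> (if x \<noteq> -2 then of_int (x + 2) else of_int (- D)))"

lemma conic_minus_two:
  assumes "D \<noteq> 0" "(-2, y) \<in> carrier (conic_group D)"
  shows "y = 0"
  using assms by (simp add: conic_group_def)

lemma conic_parity:
  fixes D x y :: int
  assumes "x\<^sup>2 - D * y\<^sup>2 = 4"
  shows "even x \<longleftrightarrow> even (D * y)"
proof -
  have "even (x\<^sup>2 - D * y\<^sup>2)"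
    by (simp add: assms)
  thus ?thesis
    by auto
qed

lemma conic_div_exact:
  fixes D r s t u :: int
  assumes "r\<^sup>2 - D * s\<^sup>2 = 4" "t\<^sup>2 - D * u\<^sup>2 = 4"
  shows "2 * ((r * t + D * s * u) div 2) = r * t + D * s * u"
    and "2 * ((r * u + s * t) div 2) = r * u + s * t"
  using conic_parity[OF assms(1)] conic_parity[OF assms(2)] by auto

lemma conic_closed:
  fixes D r s t u :: int
  assumes "r\<^sup>2 - D * s\<^sup>2 = 4" "t\<^sup>2 - D * u\<^sup>2 = 4"
  shows "((r * t + D * s * u) div 2)\<^sup>2 - D * ((r * u + s * t) div 2)\<^sup>2 = 4"
proof -
  define a where "a = (r * t + D * s * u) div 2"
  define b where "b = (r * u + s * t) div 2"
  have a: "2 * a = r * t + D * s * u" and b: "2 * b = r * u + s * t"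
    unfolding a_def b_def using conic_div_exact[OF assms] by auto
  have "4 * (a\<^sup>2 - D * b\<^sup>2) = (2 * a)\<^sup>2 - D * (2 * b)\<^sup>2"
    by (simp add: algebra_simps power2_eq_square)
  also have "\<dots> = (r\<^sup>2 - D * s\<^sup>2) * (t\<^sup>2 - D * u\<^sup>2)"
    unfolding a b by (simp add: algebra_simps power2_eq_square)
  finally have "4 * (a\<^sup>2 - D * b\<^sup>2) = 16"
    by (simp add: assms)
  thus ?thesis
    unfolding a_def[symmetric] b_def[symmetric] by simp
qed

lemma conic_assoc:
  fixes D r s t u v w :: int
  assumes h: "r\<^sup>2 - D * s\<^sup>2 = 4" "t\<^sup>2 - D * u\<^sup>2 = 4" "v\<^sup>2 - D * w\<^sup>2 = 4"
  defines "a \<equiv> (r * t + D * s * u) div 2" and "b \<equiv> (r * u + s * t) div 2"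
    and "a' \<equiv> (t * v + D * u * w) div 2" and "b' \<equiv> (t * w + u * v) div 2"
  shows "(a * v + D * b * w) div 2 = (r * a' + D * s * b') div 2"
    and "(a * w + b * v) div 2 = (r * b' + s * a') div 2"
proof -
  have a: "2 * a = r * t + D * s * u" and b: "2 * b = r * u + s * t"
    unfolding a_def b_def using conic_div_exact[OF h(1,2)] by auto
  have a': "2 * a' = t * v + D * u * w" and b': "2 * b' = t * w + u * v"
    unfolding a'_def b'_def using conic_div_exact[OF h(2,3)] by auto
  have "2 * (a * v + D * b * w) = (2 * a) * v + D * (2 * b) * w"
    by (simp add: algebra_simps)
  also have "\<dots> = r * (2 * a') + D * s * (2 * b')"
    unfolding a b a' b' by (simp add: algebra_simps)
  finally have 1: "a * v + D * b * w = r * a' + D * s * b'"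
    by (simp add: algebra_simps)
  have "2 * (a * w + b * v) = (2 * a) * w + (2 * b) * v"
    by (simp add: algebra_simps)
  also have "\<dots> = r * (2 * b') + s * (2 * a')"
    unfolding a b a' b' by (simp add: algebra_simps)
  finally have 2: "a * w + b * v = r * b' + s * a'"
    by (simp add: algebra_simps)
  show "(a * v + D * b * w) div 2 = (r * a' + D * s * b') div 2"
    and "(a * w + b * v) div 2 = (r * b' + s * a') div 2"
    by (simp_all only: 1 2)
qed

lemma comm_group_conic_group: "comm_group (conic_group D)"
proof (rule comm_groupI)
  fix p q assume "p \<in> carrier (conic_group D)" "q \<in> carrier (conic_group D)"
  then show "p \<otimes>\<^bsub>conic_group D\<^esub> q \<in> carrier (conic_group D)"
    by (auto simp: conic_group_def conic_closed)
  show "p \<otimes>\<^bsub>conic_group D\<^esub> q = q \<otimes>\<^bsub>conic_group D\<^esub> p"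
    by (auto simp: conic_group_def algebra_simps split: prod.splits)
next
  show "\<one>\<^bsub>conic_group D\<^esub> \<in> carrier (conic_group D)"
    by (simp add: conic_group_def)
next
  fix p q z
  assume "p \<in> carrier (conic_group D)" "q \<in> carrier (conic_group D)" "z \<in> carrier (conic_group D)"
  then show "p \<otimes>\<^bsub>conic_group D\<^esub> q \<otimes>\<^bsub>conic_group D\<^esub> z =
      p \<otimes>\<^bsub>conic_group D\<^esub> (q \<otimes>\<^bsub>conic_group D\<^esub> z)"
    by (auto simp: conic_group_def conic_assoc)
next
  fix p assume "p \<in> carrier (conic_group D)"
  then show "\<one>\<^bsub>conic_group D\<^esub> \<otimes>\<^bsub>conic_group D\<^esub> p = p"
    by (auto simp: conic_group_def)
next
  fix p assume p: "p \<in> carrier (conic_group D)"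
  obtain x y where xy: "p = (x, y)"
    by (cases p)
  have h: "x * x - D * (y * y) = 4"
    using p by (simp add: conic_group_def xy power2_eq_square)
  then have "(x, - y) \<otimes>\<^bsub>conic_group D\<^esub> p = \<one>\<^bsub>conic_group D\<^esub>"
    by (simp add: conic_group_def xy algebra_simps)
  moreover have "(x, - y) \<in> carrier (conic_group D)"
    using p by (simp add: conic_group_def xy)
  ultimately show "\<exists>q\<in>carrier (conic_group D). q \<otimes>\<^bsub>conic_group D\<^esub> p = \<one>\<^bsub>conic_group D\<^esub>"
    by blast
qed

lemma comm_group_rat_units: "comm_group rat_units"
proof (rule comm_groupI)
  fix p assume "p \<in> carrier rat_units"
  then show "\<exists>q\<in>carrier rat_units. q \<otimes>\<^bsub>rat_units\<^esub> p = \<one>\<^bsub>rat_units\<^esub>"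
    by (intro bexI[of _ "inverse p"]) (auto simp: rat_units_def)
qed (auto simp: rat_units_def)

lemma subgroup_rat_squares: "subgroup rat_squares rat_units"
proof -
  interpret comm_group rat_units
    by (rule comm_group_rat_units)
  show ?thesis
  proof (rule subgroupI)
    show "rat_squares \<subseteq> carrier rat_units" "rat_squares \<noteq> {}"
      by (auto simp: rat_squares_def rat_units_def intro: exI[of _ 1])
  next
    fix a assume "a \<in> rat_squares"
    then obtain q where q: "a = q\<^sup>2" "q \<noteq> 0"
      by (auto simp: rat_squares_def)
    have "inv\<^bsub>rat_units\<^esub> a = (inverse q)\<^sup>2"
      by (rule inv_equality) (use q in \<open>auto simp: rat_units_def power2_eq_square field_simps\<close>)
    with q show "inv\<^bsub>rat_units\<^esub> a \<in> rat_squares"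
      by (auto simp: rat_squares_def)
  next
    fix a b assume "a \<in> rat_squares" "b \<in> rat_squares"
    then obtain q r where "a = q\<^sup>2" "q \<noteq> 0" "b = r\<^sup>2" "r \<noteq> 0"
      by (auto simp: rat_squares_def)
    then have "a * b = (q * r)\<^sup>2" "q * r \<noteq> 0"
      by (auto simp: power_mult_distrib)
    then show "a \<otimes>\<^bsub>rat_units\<^esub> b \<in> rat_squares"
      unfolding rat_squares_def rat_units_def by auto
  qed
qed

lemma conic_alpha_closed:
  assumes "D \<noteq> 0"
  shows "conic_alpha D \<in> carrier (conic_group D) \<rightarrow> carrier (rat_units Mod rat_squares)"
proof
  fix p assume "p \<in> carrier (conic_group D)"
  obtain x y where p: "p = (x, y)"
    by (cases p)
  let ?c = "if x \<noteq> -2 then of_int (x + 2) else of_int (- D) :: rat"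
  have "x + 2 \<noteq> 0" if "x \<noteq> -2"
    using that by linarith
  then have "?c \<noteq> 0"
    using assms by (metis neg_equal_0_iff_equal of_int_eq_0_iff)
  then have "?c \<in> carrier rat_units"
    by (simp add: rat_units_def)
  then show "conic_alpha D p \<in> carrier (rat_units Mod rat_squares)"
    unfolding conic_alpha_def p FactGroup_def RCOSETS_def by auto
qed

end

theory Submission
  imports Defs Complex_Main
begin

text \<open>
  The fibres of \<open>\<alpha>\<close> are exactly the cosets of the subgroup of doubles: multiplicativity of \<open>\<alpha>\<close>
  comes from the identity \<open>(r + 2) (t + 2) (x + 2) = (r + t + x + 2)\<^sup>2\<close>, where \<open>x\<close> is the first
  coordinate of \<open>(r, s) + (t, u)\<close>, and if \<open>x + 2 = t\<^sup>2\<close> then, \<open>d\<close> being squarefree, \<open>t\<close> divides \<open>y\<close>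
  and \<open>(x, y)\<close> is the double of \<open>(t, y / t)\<close>. So the image of \<open>\<alpha>\<close> is the group modulo doubles, which
  has four elements when the group is \<open>\<int>/2 \<oplus> \<int>\<close>. Conversely, an image with four elements forces a
  point other than \<open>(\<plusminus>2, 0)\<close>; as \<open>(x, y) \<mapsto> (x + y \<surd>\<Delta>) / 2\<close> embeds the group into the nonzero reals,
  the point of least value above 1 then generates it up to sign.
\<close>

section \<open>Squares\<close>

text \<open>Cancelling square factors is what lets square classes of rationals be compared by
  integer identities alone; the point is that \<open>c^2\<close> dividing \<open>b^2\<close> forces
  \<open>c\<close> to divide \<open>b\<close>.\<close>

lemma int_square_dvd_cancel:
  fixes a b c :: int
  assumes "a * c\<^sup>2 = b\<^sup>2" "c \<noteq> 0"
  shows "\<exists>m. a = m\<^sup>2"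
proof -
  have "c\<^sup>2 dvd b\<^sup>2"
    using assms(1) by (metis dvd_triv_right)
  then have "c dvd b"
    by simp
  then obtain m where "b = c * m" ..
  then have "a = m\<^sup>2"
    using assms by (simp add: power_mult_distrib)
  then show ?thesis ..
qed

lemma of_int_rat_square_imp_square:
  fixes q :: rat
  assumes "of_int n = q\<^sup>2"
  shows "\<exists>m. n = m\<^sup>2"
proof -
  obtain a b where q: "q = of_int a / of_int b" "b \<noteq> 0"
    by (metis quotient_of_div quotient_of_denom_pos less_irrefl surj_pair)
  then have "(of_int (n * b\<^sup>2) :: rat) = of_int (a\<^sup>2)"
    using assms by (simp add: power_divide)
  then have "n * b\<^sup>2 = a\<^sup>2"
    by (simp only: of_int_eq_iff)
  then show ?thesis
    using int_square_dvd_cancel q(2) by blast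
qed

text \<open>After division by the gcd of \<open>t\<close> and \<open>y\<close>, the square of the
  remaining factor of \<open>t\<close> is coprime to that of \<open>y\<close>, so it divides
  \<open>d\<close> and the factor is a unit.\<close>

lemma square_dvd_squarefree_mult:
  fixes d t y :: int
  assumes "squarefree d" "t \<noteq> 0" "t\<^sup>2 dvd d * y\<^sup>2"
  shows "t dvd y"
proof -
  define g where "g = gcd t y"
  obtain t' y' where t': "t = g * t'" and y': "y = g * y'" and cop: "coprime t' y'"
    using gcd_coprime_exists[of t y] assms(2) unfolding g_def by (auto simp: mult.commute)
  have "g \<noteq> 0"
    using assms(2) by (simp add: g_def)
  then have "t'\<^sup>2 dvd d * y'\<^sup>2"
    using assms(3) by (simp add: t' y' power_mult_distrib mult.left_commute)
  moreover have "coprime (t'\<^sup>2) (y'\<^sup>2)"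
    using cop by simp
  ultimately have "t'\<^sup>2 dvd d"
    by (simp add: coprime_dvd_mult_left_iff)
  then have "t' dvd 1"
    using assms(1) by (auto dest: squarefreeD)
  then show ?thesis
    unfolding t' y' by (metis dvd_refl dvd_trans mult_dvd_mono one_dvd)
qed

text \<open>The quotient \<open>a / b\<close> and the product \<open>a * b\<close> differ by the
  square \<open>b^2\<close>, so equality of classes can be tested on an integer; a rational square
  root of an integer is itself integral.\<close>

lemma rat_squares_coset_eq_iff:
  assumes "a \<noteq> 0" "b \<noteq> 0"
  shows "rat_squares #>\<^bsub>rat_units\<^esub> of_int a = rat_squares #>\<^bsub>rat_units\<^esub> of_int b
    \<longleftrightarrow> (\<exists>c. a * b = c\<^sup>2)" (is "?A = ?B \<longleftrightarrow> ?R")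
proof
  assume eq: "?A = ?B"
  have "1 \<in> rat_squares"
    by (auto simp: rat_squares_def intro: exI[of _ 1])
  then have "of_int a \<in> ?A"
    by (force simp: r_coset_def rat_units_def)
  then have "of_int a \<in> ?B"
    using eq by simp
  then obtain q :: rat where "of_int a = q\<^sup>2 * of_int b"
    by (auto simp: r_coset_def rat_units_def rat_squares_def)
  then have "of_int (a * b) = (q * of_int b)\<^sup>2"
    by (simp add: power2_eq_square)
  then show ?R
    by (rule of_int_rat_square_imp_square)
next
  have sub: "rat_squares #>\<^bsub>rat_units\<^esub> of_int a \<subseteq> rat_squares #>\<^bsub>rat_units\<^esub> of_int b"
    if ab: "a \<noteq> 0" "b \<noteq> 0" "a * b = c\<^sup>2" for a b c :: int
  proof
    fix z assume "z \<in> rat_squares #>\<^bsub>rat_units\<^esub> of_int a"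
    then obtain q where q: "z = q\<^sup>2 * of_int a" "q \<noteq> 0"
      by (auto simp: r_coset_def rat_units_def rat_squares_def)
    have "(of_int a :: rat) * of_int b = (of_int c)\<^sup>2"
      using ab(3) by (metis of_int_mult of_int_power)
    \<comment> \<open>From \<open>a * b = c^2\<close> one gets \<open>a = (c / b)^2 * b\<close>, so
      the square factor \<open>q^2\<close> is scaled by \<open>(c / b)^2\<close>.\<close>
    then have "z = (q * of_int c / of_int b)\<^sup>2 * of_int b"
      using q ab by (simp add: field_simps power2_eq_square)
    moreover have "c \<noteq> 0"
      using ab by auto
    ultimately show "z \<in> rat_squares #>\<^bsub>rat_units\<^esub> of_int b"
      using q ab by (auto simp: r_coset_def rat_units_def rat_squares_def
          intro!: exI[of _ "(q * of_int c / of_int b)\<^sup>2"] exI[of _ "q * of_int c / of_int b"])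
  qed
  assume ?R
  then obtain c where "a * b = c\<^sup>2" ..
  then show "?A = ?B"
    using sub[of a b c] sub[of b a c] assms by (simp add: mult.commute)
qed

section \<open>The fibres of \<open>\<alpha>\<close>\<close>

text \<open>An integer representing the square class \<alpha>(x, y), so that multiplicativity can be
  proved inside the integers.\<close>

definition alpha_rep :: "int \<Rightarrow> int \<times> int \<Rightarrow> int" where
  "alpha_rep D = (\<lambda>(x, y). if x \<noteq> -2 then x + 2 else - D)"

lemma conic_alpha_rep:
  "conic_alpha D p = rat_squares #>\<^bsub>rat_units\<^esub> of_int (alpha_rep D p)"
  by (cases p) (simp add: conic_alpha_def alpha_rep_def)

lemma alpha_rep_nonzero: "D \<noteq> 0 \<Longrightarrow> alpha_rep D p \<noteq> 0"
  by (cases p) (auto simp: alpha_rep_def)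

lemma conic_carrier_iff: "(x, y) \<in> carrier (conic_group D) \<longleftrightarrow> x\<^sup>2 - D * y\<^sup>2 = 4"
  by (simp add: conic_group_def)

lemma conic_mult:
  "(r, s) \<otimes>\<^bsub>conic_group D\<^esub> (t, u) = ((r * t + D * s * u) div 2, (r * u + s * t) div 2)"
  by (simp add: conic_group_def)

lemma conic_one: "\<one>\<^bsub>conic_group D\<^esub> = (2, 0)"
  by (simp add: conic_group_def)

lemma conic_inv:
  assumes "(x, y) \<in> carrier (conic_group D)"
  shows "inv\<^bsub>conic_group D\<^esub> (x, y) = (x, - y)"
proof -
  interpret comm_group "conic_group D"
    by (rule comm_group_conic_group)
  have "x * x - D * (y * y) = 4"
    using assms by (simp add: conic_carrier_iff power2_eq_square)
  then have "(x, - y) \<otimes>\<^bsub>conic_group D\<^esub> (x, y) = \<one>\<^bsub>conic_group D\<^esub>"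
    by (simp add: conic_mult conic_one algebra_simps)
  then show ?thesis
    using assms by (intro inv_equality) (auto simp: conic_carrier_iff)
qed

lemma alpha_rep_inv:
  assumes "p \<in> carrier (conic_group D)"
  shows "alpha_rep D (inv\<^bsub>conic_group D\<^esub> p) = alpha_rep D p"
  using assms by (cases p) (simp add: conic_inv alpha_rep_def)

lemma conic_minus_two_mult: "(-2, 0) \<otimes>\<^bsub>conic_group D\<^esub> (x, y) = (- x, - y)"
proof -
  have "(- (2 * x)) div 2 = - x" "(- (2 * y)) div 2 = - y"
    by linarith+
  then show ?thesis
    by (simp add: conic_mult)
qed

text \<open>Multiplicativity when one summand is \<open>(-2, 0)\<close>, whose representative is
  \<open>- D\<close>. Generically \<open>(x + 2) * (2 - x) = 4 - x^2 = - D * y^2\<close>; for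
  \<open>x = 2\<close> or \<open>x = -2\<close> the other two representatives are \<open>4\<close>
  and \<open>- D\<close>, whence the witness \<open>2 * D\<close>.\<close>

lemma alpha_rep_mult_minus_two:
  assumes "D \<noteq> 0" "(x, y) \<in> carrier (conic_group D)"
  shows "\<exists>c. - D * alpha_rep D (x, y) * alpha_rep D (- x, - y) = c\<^sup>2"
proof -
  have h: "x\<^sup>2 = D * y\<^sup>2 + 4"
    using assms by (simp add: conic_carrier_iff)
  consider "x = 2" | "x = -2" | "x \<noteq> 2" "x \<noteq> -2" by blast
  then show ?thesis
  proof cases
    case 3
    then have "- D * alpha_rep D (x, y) * alpha_rep D (- x, - y) = - D * ((x + 2) * (2 - x))"
      by (simp add: alpha_rep_def)
    also have "(x + 2) * (2 - x) = - (D * y\<^sup>2)"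
      using h by (simp add: algebra_simps power2_eq_square)
    also have "- D * (- (D * y\<^sup>2)) = (D * y)\<^sup>2"
      by (simp add: power2_eq_square)
    finally show ?thesis ..
  next
    case 1
    then show ?thesis
      by (intro exI[of _ "2 * D"]) (simp add: alpha_rep_def power2_eq_square)
  next
    case 2
    then show ?thesis
      by (intro exI[of _ "2 * D"]) (simp add: alpha_rep_def power2_eq_square)
  qed
qed

text \<open>Every square class is its own inverse, so the homomorphism law can be put symmetrically:
  the three representatives multiply to a square. If one of the three points is
  \<open>(-2, 0)\<close>, the previous lemma applies.\<close>

lemma alpha_rep_mult:
  assumes D: "D \<noteq> 0" and p: "p \<in> carrier (conic_group D)" and q: "q \<in> carrier (conic_group D)"
  shows "\<exists>c. alpha_rep D p * alpha_rep D q * alpha_rep D (p \<otimes>\<^bsub>conic_group D\<^esub> q) = c\<^sup>2"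
proof -
  interpret comm_group "conic_group D"
    by (rule comm_group_conic_group)
  obtain r s t u where rs: "p = (r, s)" and tu: "q = (t, u)"
    by (cases p, cases q)
  define x y where "x = (r * t + D * s * u) div 2" and "y = (r * u + s * t) div 2"
  have pq: "p \<otimes>\<^bsub>conic_group D\<^esub> q = (x, y)"
    by (simp add: rs tu conic_mult x_def y_def)
  have hr: "r\<^sup>2 - D * s\<^sup>2 = 4" and ht: "t\<^sup>2 - D * u\<^sup>2 = 4"
    using p q by (simp_all add: rs tu conic_carrier_iff)
  consider "r = -2" | "t = -2" | "x = -2" | "r \<noteq> -2" "t \<noteq> -2" "x \<noteq> -2"
    by blast
  then show ?thesis
  proof cases
    case 1
    then have "s = 0"
      using p D by (simp add: rs conic_group_def)
    then show ?thesis
      using alpha_rep_mult_minus_two[of D t u] q D 1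
      by (simp add: rs tu conic_minus_two_mult) (simp add: alpha_rep_def)
  next
    case 2
    then have "u = 0"
      using q D by (simp add: tu conic_group_def)
    then have "p \<otimes>\<^bsub>conic_group D\<^esub> q = (- r, - s)"
      using m_comm[OF p q] 2 by (simp add: rs tu conic_minus_two_mult)
    moreover have "alpha_rep D q = - D"
      using 2 by (simp add: tu alpha_rep_def)
    ultimately show ?thesis
      using alpha_rep_mult_minus_two[of D r s] p D by (simp add: rs ac_simps)
  next
    case 3
    have "(x, y) \<in> carrier (conic_group D)"
      using m_closed[OF p q] by (simp add: pq)
    then have y: "y = 0"
      using 3 D by (simp add: conic_group_def)
    \<comment> \<open>Solving for \<open>q\<close> when the sum is \<open>(-2, 0)\<close> gives
      \<open>(- r, s)\<close>. Since \<open>alpha_rep\<close> ignores the second coordinate, the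
      sign of \<open>s\<close> is immaterial.\<close>
    have "q = inv\<^bsub>conic_group D\<^esub> p \<otimes>\<^bsub>conic_group D\<^esub> (p \<otimes>\<^bsub>conic_group D\<^esub> q)"
      using p q by (simp add: inv_solve_left)
    also have "\<dots> = (p \<otimes>\<^bsub>conic_group D\<^esub> q) \<otimes>\<^bsub>conic_group D\<^esub> inv\<^bsub>conic_group D\<^esub> p"
      using p q by (intro m_comm) auto
    also have "\<dots> = (- r, s)"
      using p by (simp only: pq 3 y) (simp add: rs conic_inv conic_minus_two_mult)
    finally have q': "q = (- r, s)" .
    have "alpha_rep D q = alpha_rep D (- r, - s)"
      by (simp add: q' alpha_rep_def)
    moreover have "alpha_rep D (p \<otimes>\<^bsub>conic_group D\<^esub> q) = - D"
      using 3 by (simp add: pq alpha_rep_def)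
    ultimately show ?thesis
      using alpha_rep_mult_minus_two[of D r s] p D by (simp add: rs ac_simps)
  next
    case 4
    have x: "2 * x = r * t + D * s * u"
      unfolding x_def by (rule conic_div_exact[OF hr ht])
    \<comment> \<open>With \<open>z\<close> and \<open>w\<close> the norm one elements of \<open>p\<close> and \<open>q\<close>, one has \<open>r + 2 = (z + 1)\<^sup>2 / z\<close> etc.,
      and \<open>(z + 1) (w + 1) (z w + 1) / (z w) = r + t + x + 2\<close>.\<close>
    have "(2 * x - r * t)\<^sup>2 = (D * s\<^sup>2) * (D * u\<^sup>2)"
      unfolding x by (simp add: power2_eq_square)
    also have "D * s\<^sup>2 = r\<^sup>2 - 4"
      using hr by simp
    also have "D * u\<^sup>2 = t\<^sup>2 - 4"
      using ht by simp
    finally have "4 * x\<^sup>2 - 4 * (x * r * t) = 16 - 4 * r\<^sup>2 - 4 * t\<^sup>2"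
      by (simp add: power2_eq_square algebra_simps)
    then have "x\<^sup>2 + r\<^sup>2 + t\<^sup>2 = x * r * t + 4"
      by linarith
    \<comment> \<open>Squaring has eliminated \<open>s\<close> and \<open>u\<close>; the resulting
      relation says precisely that the difference of the two sides here vanishes.\<close>
    then have "(r + 2) * (t + 2) * (x + 2) = (r + t + x + 2)\<^sup>2"
      by (simp add: power2_eq_square algebra_simps)
    with 4 show ?thesis
      by (auto simp: rs tu pq[unfolded rs tu] alpha_rep_def)
  qed
qed

text \<open>Substituting \<open>x = t^2 - 2\<close> turns the conic equation into
  \<open>(t^2 - 4) * t^2 = D * y^2\<close>. Once \<open>y = t * u\<close>, cancelling
  \<open>t^2\<close> places \<open>(t, u)\<close> on the conic.\<close>

lemma conic_square_if:
  assumes sf: "squarefree d" and D: "D = disc d"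
    and xy: "(x, y) \<in> carrier (conic_group D)" and t: "x + 2 = t\<^sup>2" "t \<noteq> 0"
  shows "\<exists>z\<in>carrier (conic_group D). (x, y) = z \<otimes>\<^bsub>conic_group D\<^esub> z"
proof -
  have h: "(t\<^sup>2 - 4) * t\<^sup>2 = D * y\<^sup>2"
  proof -
    have "(t\<^sup>2 - 4) * t\<^sup>2 = x\<^sup>2 - 4"
      unfolding t(1)[symmetric] by (simp add: algebra_simps power2_eq_square)
    then show ?thesis
      using xy by (simp add: conic_carrier_iff)
  qed
  have "\<exists>u. y = t * u"
  proof (cases "d mod 4 = 1")
    case True
    then have "t\<^sup>2 dvd d * y\<^sup>2"
      using h D by (metis disc_def dvd_triv_right)
    then show ?thesis
      using square_dvd_squarefree_mult[OF sf t(2)] by blast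
  next
    case False
    \<comment> \<open>Now \<open>D\<close> is not squarefree, and squarefreeness of \<open>d\<close>
      only yields that \<open>t\<close> divides \<open>2 * y\<close>. The missing factor 2 comes
      from the parity of the cofactor \<open>v\<close>.\<close>
    then have D4: "D = 4 * d"
      by (simp add: D disc_def)
    then have h2: "(t\<^sup>2 - 4) * t\<^sup>2 = d * (2 * y)\<^sup>2"
      using h by (simp add: power_mult_distrib)
    then have "t\<^sup>2 dvd d * (2 * y)\<^sup>2"
      by (metis dvd_triv_right)
    then have "t dvd 2 * y"
      by (rule square_dvd_squarefree_mult[OF sf t(2)])
    then obtain v where v: "2 * y = t * v" ..
    then have "(t\<^sup>2 - 4) * t\<^sup>2 = d * v\<^sup>2 * t\<^sup>2"
      using h2 by (simp add: power_mult_distrib ac_simps)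
    then have eq: "t\<^sup>2 = d * v\<^sup>2 + 4"
      using t(2) by simp
    \<comment> \<open>For odd \<open>v\<close> the equation gives \<open>t^2\<close> congruent to
      \<open>d\<close> modulo 4. A square is 0 or 1 there and \<open>d\<close> is not 1, so 4 would
      divide the squarefree \<open>d\<close>.\<close>
    have "even v"
    proof (rule ccontr)
      assume "odd v"
      then obtain k where k: "v = 2 * k + 1" by (elim oddE)
      have "t\<^sup>2 = d + 4 * (d * (k\<^sup>2 + k) + 1)"
        unfolding eq k by (simp add: algebra_simps power2_eq_square)
      then have "t\<^sup>2 mod 4 = d mod 4"
        by (simp only: mod_mult_self2)
      moreover have "t\<^sup>2 mod 4 = 0 \<or> t\<^sup>2 mod 4 = 1"
      proof (cases "even t")
        case True
        then obtain j where "t = 2 * j" by (elim evenE)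
        then show ?thesis by (simp add: power_mult_distrib)
      next
        case False
        then obtain j where "t = 2 * j + 1" by (elim oddE)
        then have "t\<^sup>2 = 1 + 4 * (j\<^sup>2 + j)"
          by (simp add: algebra_simps power2_eq_square)
        then show ?thesis by (simp only: mod_mult_self2) simp
      qed
      ultimately have "4 dvd d"
        using False by auto
      then have "(2::int)\<^sup>2 dvd d"
        by simp
      then have "(2::int) dvd 1"
        by (rule squarefreeD[OF sf])
      then show False
        by simp
    qed
    then obtain u where "v = 2 * u" by (elim evenE)
    then show ?thesis
      using v by auto
  qed
  then obtain u where u: "y = t * u" ..
  then have "(t\<^sup>2 - 4) * t\<^sup>2 = D * u\<^sup>2 * t\<^sup>2"
    using h by (simp add: power_mult_distrib ac_simps)
  then have tu: "t\<^sup>2 - 4 = D * u\<^sup>2"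
    using t(2) by simp
  have "t * t + D * u * u = 2 * x"
    using tu t(1) by (simp add: power2_eq_square)
  then have "(x, y) = (t, u) \<otimes>\<^bsub>conic_group D\<^esub> (t, u)"
    by (simp add: conic_mult u mult.commute)
  moreover have "(t, u) \<in> carrier (conic_group D)"
    using tu by (simp add: conic_carrier_iff)
  ultimately show ?thesis by blast
qed

text \<open>A point and its inverse have the same representative, so by multiplicativity equal
  classes make the representative of the difference of \<open>p\<close> and \<open>q\<close> a
  square, and the difference can be halved.\<close>

lemma conic_alpha_eq_iff:
  assumes sf: "squarefree d" and D: "D = disc d" "D > 0"
    and p: "p \<in> carrier (conic_group D)" and q: "q \<in> carrier (conic_group D)"
  shows "conic_alpha D p = conic_alpha D q \<longleftrightarrow>
    (\<exists>z\<in>carrier (conic_group D). p = q \<otimes>\<^bsub>conic_group D\<^esub> (z \<otimes>\<^bsub>conic_group D\<^esub> z))"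
proof -
  interpret comm_group "conic_group D"
    by (rule comm_group_conic_group)
  have D0: "D \<noteq> 0" using D by simp
  note nz = alpha_rep_nonzero[OF D0]
  have iff: "conic_alpha D p = conic_alpha D q \<longleftrightarrow> (\<exists>c. alpha_rep D p * alpha_rep D q = c\<^sup>2)"
    unfolding conic_alpha_rep by (intro rat_squares_coset_eq_iff nz)
  show ?thesis
    unfolding iff
  proof
    assume "\<exists>c. alpha_rep D p * alpha_rep D q = c\<^sup>2"
    then obtain c where c: "alpha_rep D p * alpha_rep D q = c\<^sup>2" ..
    obtain x y where xy: "p \<otimes>\<^bsub>conic_group D\<^esub> inv\<^bsub>conic_group D\<^esub> q = (x, y)"
      by fastforce
    have xyC: "(x, y) \<in> carrier (conic_group D)"
      using p q by (simp flip: xy)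
    obtain c' where "alpha_rep D (x, y) * c\<^sup>2 = c'\<^sup>2"
      using alpha_rep_mult[OF D0 p inv_closed[OF q]] q
      by (auto simp: alpha_rep_inv c xy mult.commute)
    moreover have "c \<noteq> 0"
      using c nz[of p] nz[of q] by auto
    ultimately obtain t where t: "alpha_rep D (x, y) = t\<^sup>2"
      using int_square_dvd_cancel by blast
    have "t \<noteq> 0"
      using t nz[of "(x, y)"] by auto
    \<comment> \<open>Positivity of \<open>D\<close> makes the representative \<open>- D\<close> of
      \<open>(-2, 0)\<close> negative, hence not a square.\<close>
    have "x \<noteq> -2"
    proof
      assume "x = -2"
      then have "- D = t\<^sup>2" using t by (simp add: alpha_rep_def)
      then show False using D(2) by (smt (verit) zero_le_power2)
    qed
    then have "x + 2 = t\<^sup>2"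
      using t by (simp add: alpha_rep_def)
    then obtain z where z: "z \<in> carrier (conic_group D)" "(x, y) = z \<otimes>\<^bsub>conic_group D\<^esub> z"
      using conic_square_if[OF sf D(1) xyC _ \<open>t \<noteq> 0\<close>] by blast
    have "p = q \<otimes>\<^bsub>conic_group D\<^esub> (p \<otimes>\<^bsub>conic_group D\<^esub> inv\<^bsub>conic_group D\<^esub> q)"
      using p q by (simp add: m_lcomm)
    then show "\<exists>z\<in>carrier (conic_group D). p = q \<otimes>\<^bsub>conic_group D\<^esub> (z \<otimes>\<^bsub>conic_group D\<^esub> z)"
      using z xy by metis
  next
    assume "\<exists>z\<in>carrier (conic_group D). p = q \<otimes>\<^bsub>conic_group D\<^esub> (z \<otimes>\<^bsub>conic_group D\<^esub> z)"
    then obtain z where z: "z \<in> carrier (conic_group D)"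
      and pz: "p = q \<otimes>\<^bsub>conic_group D\<^esub> (z \<otimes>\<^bsub>conic_group D\<^esub> z)" ..
    let ?w = "z \<otimes>\<^bsub>conic_group D\<^esub> z"
    \<comment> \<open>Multiplicativity for \<open>z\<close> with itself: the representative of a
      double times a nonzero square is a square, so it is itself a square.\<close>
    obtain c where "alpha_rep D ?w * (alpha_rep D z)\<^sup>2 = c\<^sup>2"
      using alpha_rep_mult[OF D0 z z] by (auto simp: power2_eq_square mult.commute)
    then obtain m where m: "alpha_rep D ?w = m\<^sup>2"
      using int_square_dvd_cancel nz by blast
    then have "m \<noteq> 0"
      using nz[of ?w] by auto
    obtain c' where "alpha_rep D p * alpha_rep D q * m\<^sup>2 = c'\<^sup>2"
      using alpha_rep_mult[OF D0 q, of ?w] z by (auto simp: m pz[symmetric] ac_simps)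
    then show "\<exists>c. alpha_rep D p * alpha_rep D q = c\<^sup>2"
      using int_square_dvd_cancel \<open>m \<noteq> 0\<close> by blast
  qed
qed

section \<open>Groups isomorphic to \<open>\<int>/2 \<oplus> \<int>\<close>\<close>

text \<open>The cardinality of an image depends only on the fibres. Those of \<open>h\<close>
  correspond under the isomorphism to the cosets of the doubles in \<int>/2 \<oplus> \<int>, and
  there are four of these.\<close>

lemma card_image_mod_squares:
  assumes iso: "G \<cong> integer_mod_group 2 \<times>\<times> integer_group" and G: "group G"
    and h: "\<And>x y. x \<in> carrier G \<Longrightarrow> y \<in> carrier G \<Longrightarrow>
      h x = h y \<longleftrightarrow> (\<exists>z\<in>carrier G. x = y \<otimes>\<^bsub>G\<^esub> (z \<otimes>\<^bsub>G\<^esub> z))"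
  shows "card (h ` carrier G) = 4"
proof -
  interpret group G by (rule G)
  let ?H = "integer_mod_group 2 \<times>\<times> integer_group"
  obtain \<phi> where \<phi>: "\<phi> \<in> iso G ?H"
    using iso by (auto simp: is_iso_def)
  then have hom: "\<phi> \<in> hom G ?H" and inj: "inj_on \<phi> (carrier G)" and img: "\<phi> ` carrier G = carrier ?H"
    by (auto simp: iso_def bij_betw_def)
  have cH: "carrier ?H = {0..<2} \<times> UNIV"
    by (simp add: carrier_integer_mod_group)
  \<comment> \<open>Doubling kills the first component and has the even integers as image in the
    second, so \<open>f\<close> is reduction modulo doubles.\<close>
  define f where "f = (\<lambda>(i::int, n::int). (i, n mod 2))"
  have f_iff: "f a = f b \<longleftrightarrow> (\<exists>c\<in>carrier ?H. a = b \<otimes>\<^bsub>?H\<^esub> (c \<otimes>\<^bsub>?H\<^esub> c))"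
    if ab: "a \<in> carrier ?H" "b \<in> carrier ?H" for a b
  proof -
    obtain i n j m where ab': "a = (i, n)" "b = (j, m)"
      by (cases a, cases b)
    have ij: "0 \<le> i" "i < 2" "0 \<le> j" "j < 2"
      using ab unfolding ab' cH by auto
    show ?thesis
    proof
      assume "f a = f b"
      then have "i = j" and "n mod 2 = m mod 2"
        by (auto simp: f_def ab')
      then obtain k where "n = m + 2 * k"
        by (metis mod_eqE)
      then have "a = b \<otimes>\<^bsub>?H\<^esub> ((0, k) \<otimes>\<^bsub>?H\<^esub> (0, k))"
        using \<open>i = j\<close> ij by (simp add: ab' mult_integer_mod_group)
      then show "\<exists>c\<in>carrier ?H. a = b \<otimes>\<^bsub>?H\<^esub> (c \<otimes>\<^bsub>?H\<^esub> c)"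
        by (intro bexI[of _ "(0, k)"]) (auto simp: cH)
    next
      assume "\<exists>c\<in>carrier ?H. a = b \<otimes>\<^bsub>?H\<^esub> (c \<otimes>\<^bsub>?H\<^esub> c)"
      then obtain l k where "a = b \<otimes>\<^bsub>?H\<^esub> ((l, k) \<otimes>\<^bsub>?H\<^esub> (l, k))"
        by auto
      then have "i = (j + (l + l) mod 2) mod 2" "n = m + (k + k)"
        by (simp_all add: ab' mult_integer_mod_group)
      then show "f a = f b"
        using ij by (simp add: f_def ab' flip: mult_2)
    qed
  qed
  have eq: "h x = h y \<longleftrightarrow> f (\<phi> x) = f (\<phi> y)" if xy: "x \<in> carrier G" "y \<in> carrier G" for x y
  proof -
    have "(\<exists>z\<in>carrier G. x = y \<otimes>\<^bsub>G\<^esub> (z \<otimes>\<^bsub>G\<^esub> z)) \<longleftrightarrow>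
        (\<exists>z\<in>carrier G. \<phi> x = \<phi> y \<otimes>\<^bsub>?H\<^esub> (\<phi> z \<otimes>\<^bsub>?H\<^esub> \<phi> z))"
    proof (intro bex_cong refl)
      fix z assume z: "z \<in> carrier G"
      have "\<phi> y \<otimes>\<^bsub>?H\<^esub> (\<phi> z \<otimes>\<^bsub>?H\<^esub> \<phi> z) = \<phi> (y \<otimes>\<^bsub>G\<^esub> (z \<otimes>\<^bsub>G\<^esub> z))"
        using z xy by (simp add: hom_mult[OF hom])
      then show "x = y \<otimes>\<^bsub>G\<^esub> (z \<otimes>\<^bsub>G\<^esub> z) \<longleftrightarrow> \<phi> x = \<phi> y \<otimes>\<^bsub>?H\<^esub> (\<phi> z \<otimes>\<^bsub>?H\<^esub> \<phi> z)"
        using inj_on_eq_iff[OF inj xy(1), of "y \<otimes>\<^bsub>G\<^esub> (z \<otimes>\<^bsub>G\<^esub> z)"] z xy by simp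
    qed
    also have "\<dots> \<longleftrightarrow> (\<exists>c\<in>carrier ?H. \<phi> x = \<phi> y \<otimes>\<^bsub>?H\<^esub> (c \<otimes>\<^bsub>?H\<^esub> c))"
      unfolding img[symmetric] by blast
    also have "\<dots> \<longleftrightarrow> f (\<phi> x) = f (\<phi> y)"
      using xy img by (intro f_iff[symmetric]) auto
    finally show ?thesis
      using h xy by blast
  qed
  have "card (h ` carrier G) = card ((f \<circ> \<phi>) ` carrier G)"
  proof (rule bij_betw_same_card)
    \<comment> \<open>The bijection sends a value of \<open>h\<close> to the value of
      \<open>f \<circ> \<phi>\<close> at any preimage; the choice does not matter because the fibres
      coincide.\<close>
    have "\<And>x. x \<in> carrier G \<Longrightarrow> (f \<circ> \<phi>) (inv_into (carrier G) h (h x)) = (f \<circ> \<phi>) x"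
      by (simp add: eq[symmetric] inv_into_into f_inv_into_f)
    then show "bij_betw (\<lambda>w. (f \<circ> \<phi>) (inv_into (carrier G) h w)) (h ` carrier G) ((f \<circ> \<phi>) ` carrier G)"
      by (auto simp: bij_betw_def inj_on_def image_image eq)
  qed
  also have "(f \<circ> \<phi>) ` carrier G = f ` carrier ?H"
    by (simp only: image_comp[symmetric] img)
  also have "\<dots> = {0..<2} \<times> {0..<2}"
  proof
    show "f ` carrier ?H \<subseteq> {0..<2} \<times> {0..<2}"
      unfolding cH by (auto simp: f_def)
    show "{0..<2} \<times> {0..<2} \<subseteq> f ` carrier ?H"
    proof
      fix w :: "int \<times> int" assume "w \<in> {0..<2} \<times> {0..<2}"
      then show "w \<in> f ` carrier ?H"
        unfolding cH by (intro image_eqI[of _ _ w]) (auto simp: f_def)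
    qed
  qed
  finally show ?thesis
    by (simp add: card_cartesian_product)
qed

text \<open>An internal direct product: \<open>m\<close> generates the factor of order two and
  \<open>e\<close> the infinite one. The case \<open>n = 0\<close> of the second \<open>free\<close>
  condition says that \<open>m\<close> is not the identity.\<close>

lemma iso_Z2_times_Z:
  assumes G: "comm_group G" and m: "m \<in> carrier G" "m \<otimes>\<^bsub>G\<^esub> m = \<one>\<^bsub>G\<^esub>" and e: "e \<in> carrier G"
    and free: "\<And>n::int. e [^]\<^bsub>G\<^esub> n = \<one>\<^bsub>G\<^esub> \<Longrightarrow> n = 0" "\<And>n::int. e [^]\<^bsub>G\<^esub> n \<noteq> m"
    and gen: "\<And>x. x \<in> carrier G \<Longrightarrow> \<exists>n::int. x = e [^]\<^bsub>G\<^esub> n \<or> x = m \<otimes>\<^bsub>G\<^esub> e [^]\<^bsub>G\<^esub> n"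
  shows "G \<cong> integer_mod_group 2 \<times>\<times> integer_group"
proof -
  interpret comm_group G by (rule G)
  let ?H = "integer_mod_group 2 \<times>\<times> integer_group"
  define \<mu> where "\<mu> i = (if i = 0 then \<one>\<^bsub>G\<^esub> else m)" for i :: int
  define f where "f = (\<lambda>(i::int, n::int). \<mu> i \<otimes>\<^bsub>G\<^esub> e [^]\<^bsub>G\<^esub> n)"
  have cH: "carrier ?H = {0, 1} \<times> UNIV"
    by (auto simp: carrier_integer_mod_group)
  have grp: "group ?H"
    by (intro DirProd_group group_integer_mod_group) auto
  have \<mu>: "\<mu> i \<in> carrier G" for i
    using m by (simp add: \<mu>_def)
  have \<mu>_add: "\<mu> ((i + j) mod 2) = \<mu> i \<otimes>\<^bsub>G\<^esub> \<mu> j" if "i \<in> {0, 1}" "j \<in> {0, 1}" for i j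
    using that m by (auto simp: \<mu>_def)
  have ep: "e [^]\<^bsub>G\<^esub> n \<in> carrier G" for n :: int
    using e by simp
  have "f \<in> hom ?H G"
  proof (rule homI)
    fix a assume "a \<in> carrier ?H"
    show "f a \<in> carrier G"
      using \<mu> ep by (simp add: f_def split: prod.split)
  next
    fix a b assume "a \<in> carrier ?H" "b \<in> carrier ?H"
    then obtain i n j k where ab: "a = (i, n)" "b = (j, k)" "i \<in> {0, 1}" "j \<in> {0, 1}"
      unfolding cH by blast
    have "f (a \<otimes>\<^bsub>?H\<^esub> b) = (\<mu> i \<otimes>\<^bsub>G\<^esub> \<mu> j) \<otimes>\<^bsub>G\<^esub> (e [^]\<^bsub>G\<^esub> n \<otimes>\<^bsub>G\<^esub> e [^]\<^bsub>G\<^esub> k)"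
      using ab e by (simp add: f_def mult_integer_mod_group \<mu>_add int_pow_mult)
    also have "\<dots> = f a \<otimes>\<^bsub>G\<^esub> f b"
      using \<mu> ep by (simp add: f_def ab m_ac)
    finally show "f (a \<otimes>\<^bsub>?H\<^esub> b) = f a \<otimes>\<^bsub>G\<^esub> f b" .
  qed
  then interpret f: group_hom ?H G f
    using grp by (simp add: group_hom_def group_hom_axioms_def)
  have "inj_on f (carrier ?H)"
  proof (rule f.inj_on_one_iff[THEN iffD2], intro allI impI)
    fix a assume a: "a \<in> carrier ?H" "f a = \<one>\<^bsub>G\<^esub>"
    obtain i n where an: "a = (i, n)" "i \<in> {0, 1}"
      using a(1) unfolding cH by blast
    have "i = 0"
    proof (rule ccontr)
      assume "i \<noteq> 0"
      then have "m \<otimes>\<^bsub>G\<^esub> e [^]\<^bsub>G\<^esub> n = \<one>\<^bsub>G\<^esub>"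
        using a(2) by (simp add: an f_def \<mu>_def)
      \<comment> \<open>The identity equals \<open>m\<close> times \<open>m\<close>, so
        \<open>m\<close> cancels on the left.\<close>
      then have "e [^]\<^bsub>G\<^esub> n = m"
        using m ep by (metis l_cancel)
      then show False using free(2) by blast
    qed
    moreover have "n = 0"
      using a(2) \<open>i = 0\<close> ep by (intro free(1)) (simp add: an f_def \<mu>_def)
    ultimately show "a = \<one>\<^bsub>?H\<^esub>"
      by (simp add: an)
  qed
  moreover have "carrier G \<subseteq> f ` carrier ?H"
  proof
    fix x assume "x \<in> carrier G"
    then obtain n :: int where "x = e [^]\<^bsub>G\<^esub> n \<or> x = m \<otimes>\<^bsub>G\<^esub> e [^]\<^bsub>G\<^esub> n"
      using gen by blast
    then have "x = f (0, n) \<or> x = f (1, n)"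
      using ep by (auto simp: f_def \<mu>_def)
    then show "x \<in> f ` carrier ?H"
      by (auto simp: cH)
  qed
  ultimately have "f \<in> iso ?H G"
    using f.homh by (auto simp: iso_def bij_betw_def)
  then have "?H \<cong> G"
    by (auto simp: is_iso_def)
  then show ?thesis
    using grp by (rule group.iso_sym[rotated])
qed

section \<open>The fundamental solution\<close>

definition conic_val :: "int \<Rightarrow> int \<times> int \<Rightarrow> real" where
  "conic_val D = (\<lambda>(x, y). (x + y * sqrt D) / 2)"

lemma conic_val_mult:
  assumes "D > 0" "p \<in> carrier (conic_group D)" "q \<in> carrier (conic_group D)"
  shows "conic_val D (p \<otimes>\<^bsub>conic_group D\<^esub> q) = conic_val D p * conic_val D q"
proof -
  obtain r s t u where rs: "p = (r, s)" and tu: "q = (t, u)"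
    by (cases p, cases q)
  define x y where "x = (r * t + D * s * u) div 2" and "y = (r * u + s * t) div 2"
  have "2 * x = r * t + D * s * u" "2 * y = r * u + s * t"
    unfolding x_def y_def using assms conic_div_exact[of r D s t u]
    by (simp_all add: rs tu conic_carrier_iff)
  then have "2 * real_of_int x = real_of_int r * t + real_of_int D * s * u"
    "2 * real_of_int y = real_of_int r * u + real_of_int s * t"
    by (metis of_int_add of_int_mult of_int_numeral)+
  moreover have "(r + s * sqrt D) * (t + u * sqrt D) =
      (real_of_int r * t + (sqrt D * sqrt D) * s * u) + (real_of_int r * u + real_of_int s * t) * sqrt D"
    by (simp only: algebra_simps)
  moreover have "sqrt D * sqrt D = D"
    using assms by simp
  ultimately have "(r + s * sqrt D) * (t + u * sqrt D) = 2 * (x + y * sqrt D)"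
    by simp
  then show ?thesis
    by (simp add: rs tu conic_mult conic_val_def flip: x_def y_def)
qed

lemma conic_val_one: "conic_val D \<one>\<^bsub>conic_group D\<^esub> = 1"
  by (simp add: conic_one conic_val_def)

text \<open>The product is the norm \<open>(x^2 - D * y^2) / 4\<close>. Hence values are nonzero,
  and conjugation gives the reciprocal.\<close>

lemma conic_val_conj:
  assumes "D > 0" "(x, y) \<in> carrier (conic_group D)"
  shows "conic_val D (x, y) * conic_val D (x, - y) = 1"
proof -
  have "x\<^sup>2 - D * y\<^sup>2 = 4"
    using assms by (simp add: conic_carrier_iff)
  then have "(real_of_int x)\<^sup>2 - real_of_int D * (real_of_int y)\<^sup>2 = 4"
    by (metis of_int_diff of_int_mult of_int_numeral of_int_power)
  moreover have "(x + y * sqrt D) * (x - y * sqrt D) = (real_of_int x)\<^sup>2 - (sqrt D * sqrt D) * (real_of_int y)\<^sup>2"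
    by (simp only: algebra_simps power2_eq_square)
  moreover have "sqrt D * sqrt D = D"
    using assms by simp
  ultimately have "(x + y * sqrt D) * (x - y * sqrt D) = 4"
    by simp
  then show ?thesis
    by (simp add: conic_val_def)
qed

text \<open>The first coordinate is the trace, the sum of the value and its conjugate. This lets
  values be compared through integers.\<close>

lemma conic_fst_eq_val:
  assumes "D > 0" "(x, y) \<in> carrier (conic_group D)"
  shows "x = conic_val D (x, y) + 1 / conic_val D (x, y)"
proof -
  have "1 / conic_val D (x, y) = conic_val D (x, - y)"
    using inverse_unique[OF conic_val_conj[OF assms]] by (simp add: divide_inverse)
  then show ?thesis
    by (simp only:) (simp add: conic_val_def field_simps)
qed

lemma conic_val_eq_one:
  assumes "D > 0" "p \<in> carrier (conic_group D)" "conic_val D p = 1"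
  shows "p = \<one>\<^bsub>conic_group D\<^esub>"
proof -
  obtain x y where p: "p = (x, y)" by fastforce
  have "x = 2"
    using conic_fst_eq_val[of D x y] assms by (simp add: p)
  then show ?thesis
    using assms by (simp add: p conic_one conic_carrier_iff)
qed

text \<open>Real powers fit the logarithm used to find exponents later. A negative exponent is
  handled through the power with the opposite exponent, whose value is the reciprocal.\<close>

lemma conic_val_pow:
  assumes "D > 0" "p \<in> carrier (conic_group D)" "conic_val D p > 0"
  shows "conic_val D (p [^]\<^bsub>conic_group D\<^esub> (n::int)) = conic_val D p powr n"
proof -
  interpret comm_group "conic_group D"
    by (rule comm_group_conic_group)
  have nat: "conic_val D (p [^]\<^bsub>conic_group D\<^esub> k) = conic_val D p ^ k" for k :: nat
  proof (induction k)
    case 0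
    show ?case by (simp add: conic_val_one)
  next
    case (Suc k)
    have "conic_val D (p [^]\<^bsub>conic_group D\<^esub> Suc k) = conic_val D (p [^]\<^bsub>conic_group D\<^esub> k) * conic_val D p"
      unfolding nat_pow_Suc by (rule conic_val_mult[OF assms(1) nat_pow_closed[OF assms(2)] assms(2)])
    then show ?case
      using Suc by (simp add: mult.commute)
  qed
  show ?thesis
  proof (cases "n \<ge> 0")
    case True
    then show ?thesis
      using nat[of "nat n"] assms(3) by (simp flip: powr_realpow)
  next
    case False
    let ?q = "p [^]\<^bsub>conic_group D\<^esub> (- n)"
    have "p [^]\<^bsub>conic_group D\<^esub> n \<otimes>\<^bsub>conic_group D\<^esub> ?q = \<one>\<^bsub>conic_group D\<^esub>"
      using assms(2) by (simp add: int_pow_neg)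
    then have "conic_val D (p [^]\<^bsub>conic_group D\<^esub> n) * conic_val D ?q = 1"
      using assms(2) conic_val_mult[OF assms(1), of "p [^]\<^bsub>conic_group D\<^esub> n" ?q]
      by (simp add: conic_val_one)
    moreover have "conic_val D ?q = conic_val D p powr (- n)"
      using nat[of "nat (- n)"] False assms(3) by (simp flip: powr_realpow)
    ultimately show ?thesis
      using assms(3) by (simp add: powr_minus field_simps)
  qed
qed

text \<open>The classical argument for Pell's equation: dividing a point of positive value by a
  suitable power of the fundamental solution leaves a value in \<open>[1, v)\<close>, which
  minimality forces to be 1.\<close>

lemma conic_iso:
  assumes D: "D > 0" and ex: "(x\<^sub>0, y\<^sub>0) \<in> carrier (conic_group D)" "y\<^sub>0 \<noteq> 0"
  shows "conic_group D \<cong> integer_mod_group 2 \<times>\<times> integer_group"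
proof -
  interpret comm_group "conic_group D"
    by (rule comm_group_conic_group)
  define P where "P = (\<lambda>p. p \<in> carrier (conic_group D) \<and> conic_val D p > 1)"
  have sq: "sqrt D > 0" using D by simp
  \<comment> \<open>With both coordinates made positive, the first exceeds 2 and the value exceeds
    1.\<close>
  have "P (\<bar>x\<^sub>0\<bar>, \<bar>y\<^sub>0\<bar>)"
  proof -
    have h: "x\<^sub>0\<^sup>2 = D * y\<^sub>0\<^sup>2 + 4"
      using ex by (simp add: conic_carrier_iff)
    have "D * y\<^sub>0\<^sup>2 > 0"
      using D ex(2) by simp
    then have "2\<^sup>2 < \<bar>x\<^sub>0\<bar>\<^sup>2"
      using h by simp
    then have "2 < \<bar>x\<^sub>0\<bar>"
      by (rule power_less_imp_less_base) simp
    moreover have "\<bar>y\<^sub>0\<bar> * sqrt D > 0"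
      using sq ex(2) by simp
    ultimately show ?thesis
      using ex by (simp add: P_def conic_val_def conic_carrier_iff)
  qed
  \<comment> \<open>Well-ordering is available for first coordinates, not for real values;
    minimality of the value is derived from it next.\<close>
  then obtain e where e: "P e" and least: "\<And>q. P q \<Longrightarrow> nat (fst e) \<le> nat (fst q)"
    using ex_has_least_nat[of P _ "\<lambda>p. nat (fst p)"] by blast
  define v where "v = conic_val D e"
  have eC: "e \<in> carrier (conic_group D)" and v: "v > 1"
    using e by (auto simp: P_def v_def)
  have fst_val: "real_of_int (fst p) = conic_val D p + 1 / conic_val D p" if "p \<in> carrier (conic_group D)" for p
    using conic_fst_eq_val[OF D, of "fst p" "snd p"] that by simp
  have min: "v \<le> conic_val D q" if q: "P q" for q
  proof (rule ccontr)
    let ?w = "conic_val D q"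
    assume "\<not> v \<le> ?w"
    then have w: "1 < ?w" "?w < v"
      using q by (auto simp: P_def)
    then have "1 * 1 < ?w * v"
      using v by (intro mult_strict_mono) auto
    \<comment> \<open>This factorization shows that \<open>w + 1 / w\<close> is strictly increasing
      for \<open>w > 1\<close>.\<close>
    then have "0 < (v - ?w) * (1 - 1 / (?w * v))"
      using w by (intro mult_pos_pos) (auto simp: divide_simps)
    also have "\<dots> = (v + 1 / v) - (?w + 1 / ?w)"
      using w v by (simp add: field_simps)
    also have "\<dots> = fst e - fst q"
      using fst_val eC q by (simp add: v_def P_def)
    finally have "fst q < fst e"
      by simp
    \<comment> \<open>Positivity ensures that the strict inequality survives \<open>nat\<close>,
      which truncates negative integers to 0.\<close>
    moreover have "real_of_int (fst q) > 0"
      using fst_val[of q] q w by (simp add: P_def add_pos_pos)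
    ultimately show False
      using least[OF q] by simp
  qed
  have val_e: "conic_val D (e [^]\<^bsub>conic_group D\<^esub> n) = v powr n" for n :: int
    using conic_val_pow[OF D eC] v by (simp add: v_def)
  have gen_pos: "\<exists>n::int. p = e [^]\<^bsub>conic_group D\<^esub> n"
    if p: "p \<in> carrier (conic_group D)" "conic_val D p > 0" for p
  proof -
    \<comment> \<open>The exponent with \<open>v powr n\<close> at most the value of
      \<open>p\<close> and \<open>v powr (n + 1)\<close> above it.\<close>
    define n where "n = \<lfloor>log v (conic_val D p)\<rfloor>"
    define q where "q = p \<otimes>\<^bsub>conic_group D\<^esub> e [^]\<^bsub>conic_group D\<^esub> (- n)"
    have q: "q \<in> carrier (conic_group D)"
      using p eC by (simp add: q_def)
    have n: "v powr n \<le> conic_val D p" "conic_val D p < v powr (n + 1)"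
      using v p(2) floor_correct[of "log v (conic_val D p)"]
      by (simp_all add: n_def powr_le_iff less_powr_iff)
    have val_q: "conic_val D q = conic_val D p / v powr n"
      using D p eC val_e[of "- n"] by (simp add: q_def conic_val_mult powr_minus_divide)
    have "1 \<le> conic_val D q" "conic_val D q < v"
      using n v by (simp_all add: val_q field_simps powr_add)
    then have "conic_val D q = 1"
      using min[of q] q by (force simp: P_def)
    then have "q = \<one>\<^bsub>conic_group D\<^esub>"
      using conic_val_eq_one[OF D q] by simp
    then have "p = e [^]\<^bsub>conic_group D\<^esub> n"
      using p eC by (simp add: q_def int_pow_neg inv_solve_right')
    then show ?thesis ..
  qed
  show ?thesis
  proof (rule iso_Z2_times_Z[OF comm_group_conic_group, of "(-2, 0)" _ e])
    show m: "(-2, 0) \<in> carrier (conic_group D)"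
      by (simp add: conic_carrier_iff)
    show "(-2, 0) \<otimes>\<^bsub>conic_group D\<^esub> (-2, 0) = \<one>\<^bsub>conic_group D\<^esub>"
      by (simp add: conic_minus_two_mult conic_one)
    show "e \<in> carrier (conic_group D)"
      by (rule eC)
    show "n = 0" if "e [^]\<^bsub>conic_group D\<^esub> n = \<one>\<^bsub>conic_group D\<^esub>" for n :: int
      using val_e[of n] v that by (simp add: conic_val_one powr_eq_one_iff_gen)
    show "e [^]\<^bsub>conic_group D\<^esub> n \<noteq> (-2, 0)" for n :: int
    proof
      assume "e [^]\<^bsub>conic_group D\<^esub> n = (-2, 0)"
      then have "v powr n = -1"
        using val_e[of n] by (simp add: conic_val_def)
      then show False
        using powr_ge_zero[of v n] by linarith
    qed
    fix p assume p: "p \<in> carrier (conic_group D)"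
    obtain x y where xy: "p = (x, y)" by fastforce
    show "\<exists>n::int. p = e [^]\<^bsub>conic_group D\<^esub> n \<or>
        p = (-2, 0) \<otimes>\<^bsub>conic_group D\<^esub> e [^]\<^bsub>conic_group D\<^esub> n"
    proof (cases "conic_val D p > 0")
      case True
      then show ?thesis using gen_pos p by blast
    next
      case False
      have "conic_val D p \<noteq> 0"
        using conic_val_conj[OF D, of x y] p by (auto simp: xy)
      \<comment> \<open>Adding \<open>(-2, 0)\<close>, whose value is -1, moves a point of negative
        value to one of positive value.\<close>
      then have "conic_val D (- x, - y) > 0"
        using False by (simp add: xy conic_val_def)
      then obtain n :: int where n: "(- x, - y) = e [^]\<^bsub>conic_group D\<^esub> n"
        using gen_pos[of "(- x, - y)"] p by (auto simp: xy conic_carrier_iff)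
      have "p = (-2, 0) \<otimes>\<^bsub>conic_group D\<^esub> (- x, - y)"
        by (simp add: xy conic_minus_two_mult)
      then show ?thesis
        using n by metis
    qed
  qed
qed

theorem theorem3p10:
  fixes d \<Delta> :: int
  assumes "squarefree d" and "d \<noteq> 1"
    and "\<Delta> = disc d"
    and "\<Delta> > 0"
  shows "conic_group \<Delta> \<cong> integer_mod_group 2 \<times>\<times> integer_group \<longleftrightarrow>
         card (conic_alpha \<Delta> ` carrier (conic_group \<Delta>)) = 4"
proof
  assume "conic_group \<Delta> \<cong> integer_mod_group 2 \<times>\<times> integer_group"
  then show "card (conic_alpha \<Delta> ` carrier (conic_group \<Delta>)) = 4"
    using comm_group_conic_group[of \<Delta>] conic_alpha_eq_iff[OF assms(1,3,4)]
    by (intro card_image_mod_squares) (auto simp: comm_group_def)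
next
  assume card: "card (conic_alpha \<Delta> ` carrier (conic_group \<Delta>)) = 4"
  have "\<exists>x y. (x, y) \<in> carrier (conic_group \<Delta>) \<and> y \<noteq> 0"
  proof (rule ccontr)
    assume no: "\<not> ?thesis"
    \<comment> \<open>With \<open>y = 0\<close> the equation reads \<open>x^2 = 4\<close>; at most
      two points remain, too few for an image of four elements.\<close>
    have "carrier (conic_group \<Delta>) \<subseteq> {(2, 0), (-2, 0)}"
    proof
      fix p assume p: "p \<in> carrier (conic_group \<Delta>)"
      obtain x y where xy: "p = (x, y)" by fastforce
      then have "y = 0" using no p by blast
      then have "x\<^sup>2 = 2\<^sup>2"
        using p by (simp add: xy conic_carrier_iff)
      then show "p \<in> {(2, 0), (-2, 0)}"
        unfolding power2_eq_iff using xy \<open>y = 0\<close> by auto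
    qed
    then have "card (conic_alpha \<Delta> ` carrier (conic_group \<Delta>)) \<le> card (conic_alpha \<Delta> ` {(2, 0), (-2, 0)})"
      by (intro card_mono image_mono) auto
    also have "\<dots> \<le> card {(2, 0), (-2, 0) :: int \<times> int}"
      by (rule card_image_le) simp
    finally show False
      using card by simp
  qed
  then show "conic_group \<Delta> \<cong> integer_mod_group 2 \<times>\<times> integer_group"
    using conic_iso[OF assms(4)] by blast
qed

end
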